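(* If a random dynamical system $\Phi:\mathbb{R}^+\times\Omega\times\mathbb{X}\to\mathbb{X}$ has a random periodic path $Y:\mathbb{R}\times\Omega\to\mathbb{X}$ of period $\tau$, then it has a periodic measure $\mu:\mathbb{R}\to\mathcal P_P(\Omega\times\mathbb{X})$ on $(\Omega\times\mathbb{X},\mathcal F\otimes\mathcal B(\mathbb{X}))$, given by $$\mu_s(A)=\int_\Omega\delta_{Y(s,\omega)}(A_{\theta(s)\omega})\,P(d\omega),$$ where $A_\omega=\{x\in\mathbb{X}:(\omega,x)\in A\}$ is the $\omega$-section of $A$. Moreover, the time average of the periodic measure $$\bar\mu=\frac1\tau\int_0^\tau\mu_s\,ds$$ is an invariant measure of $\Phi$ whose random factorisation is supported by $L^\omega=\{Y(s,\theta(-s)\omega):s\in[0,\tau)\}$.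
   Context: $\mathbb{X}$ is a Polish space with Borel $\sigma$-algebra $\mathcal B(\mathbb{X})$, $\mathbb{R}^+=[0,\infty)$. $(\Omega,\mathcal F,P,(\theta(t))_{t\in\mathbb{R}})$ is a metric dynamical system: each $\theta(t)$ is $P$-preserving and measurably invertible, $\theta(-t)=\theta(t)^{-1}$. A random dynamical system (cocycle) is a jointly measurable $\Phi:\mathbb{R}^+\times\Omega\times\mathbb{X}\to\mathbb{X}$ with $\Phi(0,\omega)=\mathrm{id}$ and $\Phi(t+s,\omega)=\Phi(t,\theta(s)\omega)\Phi(s,\omega)$ for all $s,t\in\mathbb{R}^+$ and almost all $\omega$. A random periodic path of period $\tau$ is an $\mathcal F$-measurable map $Y:\mathbb{R}\times\Omega\to\mathbb{X}$ such that for almost all $\omega$: $\Phi(t,\theta(s)\omega)Y(s,\omega)=Y(t+s,\omega)$ and $Y(s+\tau,\omega)=Y(s,\theta(\tau)\omega)$ for all $t\in\mathbb{R}^+$, $s\in\mathbb{R}$. The skew product is $\bar\Theta(t)(\omega,x)=(\theta(t)\omega,\Phi(t,\omega)x)$, $t\in\mathbb{R}^+$, and $\bar\Theta(t)\mu$ denotes the push-forward $A\mapsto\mu(\bar\Theta(t)^{-1}A)$. $\mathcal P_P(\Omega\times\mathbb{X})$ is the set of probability measures on $(\Omega\times\mathbb{X},\mathcal F\otimes\mathcal B(\mathbb{X}))$ with marginal $P$ on $(\Omega,\mathcal F)$. A map $\mu:\mathbb{R}\to\mathcal P_P(\Omega\times\mathbb{X})$ is a periodic (probability) measure of period $\tau$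 for $\Phi$ if $\mu_{\tau+s}=\mu_s$ and $\bar\Theta(t)\mu_s=\mu_{t+s}$ for all $t\in\mathbb{R}^+$, $s\in\mathbb{R}$. A measure $\mu_0\in\mathcal P_P(\Omega\times\mathbb{X})$ is an invariant measure of $\Phi$ if $\bar\Theta(t)\mu_0=\mu_0$ for all $t\in\mathbb{R}^+$. The random factorisation of $\mu\in\mathcal P_P(\Omega\times\mathbb{X})$ is the family $(\mu)_\omega$ of probability measures on $\mathbb{X}$ with $\mu(A)=\int_\Omega(\mu)_\omega(A_\omega)P(d\omega)$. *)

theory Defs
  imports "HOL-Probability.Probability"
begin

locale metric_dynamical_system = prob_space M
  for M :: "'w measure" +
  fixes \<theta> :: "real \<Rightarrow> 'w \<Rightarrow> 'w"
  assumes flow_measurable: "(\<lambda>(t, \<omega>). \<theta> t \<omega>) \<in> borel \<Otimes>\<^sub>M M \<rightarrow>\<^sub>M M"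
    and flow_zero: "\<And>\<omega>. \<omega> \<in> space M \<Longrightarrow> \<theta> 0 \<omega> = \<omega>"
    and flow_add: "\<And>s t \<omega>. \<omega> \<in> space M \<Longrightarrow> \<theta> (s + t) \<omega> = \<theta> s (\<theta> t \<omega>)"
    and flow_preserves: "\<And>t. distr M M (\<theta> t) = M"
begin

lemma flow_measurable_at: "\<theta> t \<in> M \<rightarrow>\<^sub>M M"
  using measurable_compose[OF measurable_Pair1'[of t borel M] flow_measurable] by simp

lemma flow_inverse:
  assumes "\<omega> \<in> space M"
  shows "\<theta> (- t) (\<theta> t \<omega>) = \<omega>" and "\<theta> t (\<theta> (- t) \<omega>) = \<omega>"
  using flow_add[OF assms, of "- t" t] flow_add[OF assms, of t "- t"] flow_zero[OF assms]
  by simp_all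

end

text \<open>
  Time of \<^term>\<open>\<Phi>\<close> is restricted to the nonnegative reals; values at negative times are
  irrelevant. The exceptional set in the cocycle identity may depend on \<^term>\<open>s\<close> and
  \<^term>\<open>t\<close>.
\<close>

locale random_dynamical_system = metric_dynamical_system M \<theta>
  for M :: "'w measure" and \<theta> :: "real \<Rightarrow> 'w \<Rightarrow> 'w" +
  fixes \<Phi> :: "real \<Rightarrow> 'w \<Rightarrow> 'x::polish_space \<Rightarrow> 'x"
  assumes cocycle_measurable:
      "(\<lambda>(t, \<omega>, x). \<Phi> t \<omega> x)
        \<in> restrict_space borel {0..} \<Otimes>\<^sub>M (M \<Otimes>\<^sub>M borel) \<rightarrow>\<^sub>M borel"
    and cocycle_zero: "AE \<omega> in M. \<forall>x. \<Phi> 0 \<omega> x = x"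
    and cocycle_add: "\<And>s t. 0 \<le> s \<Longrightarrow> 0 \<le> t \<Longrightarrow>
      AE \<omega> in M. \<forall>x. \<Phi> (t + s) \<omega> x = \<Phi> t (\<theta> s \<omega>) (\<Phi> s \<omega> x)"

text \<open>
  Measurability of the path is only required at each fixed time; the identities hold off a single
  null set that does not depend on the times.
\<close>

definition random_periodic_path ::
    "'w measure \<Rightarrow> (real \<Rightarrow> 'w \<Rightarrow> 'w) \<Rightarrow> (real \<Rightarrow> 'w \<Rightarrow> 'x::polish_space \<Rightarrow> 'x)
      \<Rightarrow> real \<Rightarrow> (real \<Rightarrow> 'w \<Rightarrow> 'x) \<Rightarrow> bool" where
  "random_periodic_path M \<theta> \<Phi> \<tau> Y \<longleftrightarrow>
    (\<forall>s. Y s \<in> M \<rightarrow>\<^sub>M borel) \<and>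
    (AE \<omega> in M. (\<forall>t\<ge>0. \<forall>s. \<Phi> t (\<theta> s \<omega>) (Y s \<omega>) = Y (t + s) \<omega>) \<and>
                (\<forall>s. Y (s + \<tau>) \<omega> = Y s (\<theta> \<tau> \<omega>)))"

definition skew_product ::
    "(real \<Rightarrow> 'w \<Rightarrow> 'w) \<Rightarrow> (real \<Rightarrow> 'w \<Rightarrow> 'x \<Rightarrow> 'x) \<Rightarrow> real \<Rightarrow> 'w \<times> 'x \<Rightarrow> 'w \<times> 'x" where
  "skew_product \<theta> \<Phi> t = (\<lambda>(\<omega>, x). (\<theta> t \<omega>, \<Phi> t \<omega> x))"

definition prob_measures_with_marginal ::
    "'w measure \<Rightarrow> ('w \<times> 'x::topological_space) measure set" where
  "prob_measures_with_marginal M =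
    {\<mu>. prob_space \<mu> \<and> sets \<mu> = sets (M \<Otimes>\<^sub>M borel) \<and> distr \<mu> M fst = M}"

definition periodic_measure ::
    "'w measure \<Rightarrow> (real \<Rightarrow> 'w \<Rightarrow> 'w) \<Rightarrow> (real \<Rightarrow> 'w \<Rightarrow> 'x::topological_space \<Rightarrow> 'x)
      \<Rightarrow> real \<Rightarrow> (real \<Rightarrow> ('w \<times> 'x) measure) \<Rightarrow> bool" where
  "periodic_measure M \<theta> \<Phi> \<tau> \<mu> \<longleftrightarrow>
    (\<forall>s. \<mu> s \<in> prob_measures_with_marginal M) \<and>
    (\<forall>s. \<mu> (\<tau> + s) = \<mu> s) \<and>
    (\<forall>t\<ge>0. \<forall>s. distr (\<mu> s) (M \<Otimes>\<^sub>M borel) (skew_product \<theta> \<Phi> t) = \<mu> (t + s))"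

definition invariant_measure ::
    "'w measure \<Rightarrow> (real \<Rightarrow> 'w \<Rightarrow> 'w) \<Rightarrow> (real \<Rightarrow> 'w \<Rightarrow> 'x::topological_space \<Rightarrow> 'x)
      \<Rightarrow> ('w \<times> 'x) measure \<Rightarrow> bool" where
  "invariant_measure M \<theta> \<Phi> \<mu> \<longleftrightarrow>
    \<mu> \<in> prob_measures_with_marginal M \<and>
    (\<forall>t\<ge>0. distr \<mu> (M \<Otimes>\<^sub>M borel) (skew_product \<theta> \<Phi> t) = \<mu>)"

definition section_at :: "('w \<times> 'x) set \<Rightarrow> 'w \<Rightarrow> 'x set" where
  "section_at A \<omega> = {x. (\<omega>, x) \<in> A}"

definition random_factorisation ::
    "'w measure \<Rightarrow> ('w \<times> 'x::topological_space) measure \<Rightarrow> ('w \<Rightarrow> 'x measure) \<Rightarrow> bool" where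
  "random_factorisation M \<mu> \<kappa> \<longleftrightarrow>
    \<kappa> \<in> M \<rightarrow>\<^sub>M prob_algebra borel \<and>
    (\<forall>A\<in>sets (M \<Otimes>\<^sub>M borel).
      emeasure \<mu> A = (\<integral>\<^sup>+\<omega>. emeasure (\<kappa> \<omega>) (section_at A \<omega>) \<partial>M))"

text \<open>
  The first conjunct makes the integral in the second a genuine one: \<open>nn_integral\<close> of a
  non-measurable function is merely a lower integral.
\<close>

definition time_average ::
    "real \<Rightarrow> (real \<Rightarrow> 'a measure) \<Rightarrow> 'a measure \<Rightarrow> bool" where
  "time_average \<tau> \<mu> \<nu> \<longleftrightarrow>
    (\<forall>A\<in>sets \<nu>. (\<lambda>s. emeasure (\<mu> s) A) \<in> borel_measurable borel) \<and>
    (\<forall>A\<in>sets \<nu>. emeasure \<nu> A =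
      ennreal (1 / \<tau>) * (\<integral>\<^sup>+s\<in>{0..\<tau>}. emeasure (\<mu> s) A \<partial>lborel))"

text \<open>
  The set \<open>L\<^sup>\<omega>\<close>. It need not be Borel, so that a measure is supported by it is
  expressed with \<open>AE\<close>, i.e. its complement lies in a null set.
\<close>

definition path_range ::
    "(real \<Rightarrow> 'w \<Rightarrow> 'w) \<Rightarrow> real \<Rightarrow> (real \<Rightarrow> 'w \<Rightarrow> 'x) \<Rightarrow> 'w \<Rightarrow> 'x set" where
  "path_range \<theta> \<tau> Y \<omega> = (\<lambda>s. Y s (\<theta> (- s) \<omega>)) ` {0..<\<tau>}"

end

theory Submission
  imports Defs
begin

text \<open>
  Up to one null set, \<open>Y s \<omega> = \<Phi> s \<omega> (Y 0 \<omega>)\<close> for all \<open>s \<ge> 0\<close>, so \<open>Y\<close> has a jointly measurable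
  version on nonnegative times, although it is only assumed measurable at each fixed time.
  Let \<open>\<mu>\<^sub>s\<close> be the law of \<open>(\<theta> s \<omega>, Y s \<omega>)\<close>: the cocycle identity of the path gives equivariance,
  and periodicity of the path with invariance of \<open>P\<close> gives periodicity of \<open>\<mu>\<close>. Integrating over
  a period yields an invariant measure because the integral of a periodic function over a period
  does not change under translation. Substituting \<open>\<theta> (- s) \<omega>\<close> for \<open>\<omega>\<close> shows that the time
  average factorises through the law of \<open>s \<mapsto> Y s (\<theta> (- s) \<omega>)\<close> for \<open>s\<close> uniform on \<open>[0, \<tau>)\<close>. This
  law lives on \<open>L\<^sup>\<omega>\<close>, and factorisations are almost surely unique since the Borel \<open>\<sigma>\<close>-algebra of
  a Polish space is countably generated.
\<close>

section \<open>Tools: Borel images, generators, periodic integrals, uniqueness of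
  factorisations\<close>

text \<open>
  The image of a Borel set need not be Borel. Inner regularity of the law of \<open>(s, f s)\<close> on the
  graph of \<open>f\<close> over \<open>S\<close> yields compact subsets of the graph, whose projections are compact subsets
  of the image that exhaust its mass.
\<close>

lemma AE_distr_image:
  fixes f :: "'a::{second_countable_topology, complete_space} \<Rightarrow> 'b::{second_countable_topology, complete_space}"
  assumes "finite_measure N" and sets_N: "sets N = sets borel"
    and f [measurable]: "f \<in> borel \<rightarrow>\<^sub>M borel"
    and S [measurable]: "S \<in> sets borel" and AE_S: "AE s in N. s \<in> S"
  shows "AE x in distr N borel f. x \<in> f ` S"
proof -
  interpret N: finite_measure N by fact
  note [measurable_cong] = sets_N
  define \<nu> where "\<nu> = distr N (borel :: ('a \<times> 'b) measure) (\<lambda>s. (s, f s))"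
  have graph [measurable]: "(\<lambda>s. (s, f s)) \<in> N \<rightarrow>\<^sub>M (borel :: ('a \<times> 'b) measure)"
    unfolding borel_prod[symmetric] by measurable
  have sets_\<nu>: "sets \<nu> = sets borel"
    by (simp add: \<nu>_def)
  interpret \<nu>: finite_measure \<nu>
    unfolding \<nu>_def by (rule N.finite_measure_distr) simp
  \<comment> \<open>The graph is written with \<open>dist\<close> so that its measurability reduces
    to that of a real-valued function.\<close>
  define \<Gamma> where "\<Gamma> = {p :: 'a \<times> 'b. fst p \<in> S \<and> dist (f (fst p)) (snd p) = 0}"
  have \<Gamma> [measurable]: "\<Gamma> \<in> sets (borel :: ('a \<times> 'b) measure)"
  proof -
    have "{p \<in> space (borel \<Otimes>\<^sub>M borel). fst p \<in> S \<and> dist (f (fst p)) (snd p) = 0}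
        \<in> sets (borel \<Otimes>\<^sub>M borel)"
      by measurable
    then show ?thesis
      unfolding \<Gamma>_def borel_prod by (simp add: space_pair_measure)
  qed
  have \<nu>_\<Gamma>: "emeasure \<nu> \<Gamma> = emeasure N (space N)"
    unfolding \<nu>_def emeasure_distr[OF graph \<Gamma>]
  proof (rule emeasure_eq_AE)
    show "AE s in N. s \<in> (\<lambda>s. (s, f s)) -` \<Gamma> \<inter> space N \<longleftrightarrow> s \<in> space N"
      using AE_S AE_space by eventually_elim (simp add: \<Gamma>_def)
  qed (use measurable_sets[OF graph \<Gamma>] in simp_all)
  have dist: "emeasure (distr N borel f) (space (distr N borel f)) = emeasure N (space N)"
    by (subst emeasure_distr) (auto simp: sets_eq_imp_space_eq[OF sets_N])
  interpret D: finite_measure "distr N borel f"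
    by (rule N.finite_measure_distr) simp
  have "emeasure N (space N) = (SUP K \<in> {K. K \<subseteq> \<Gamma> \<and> compact K}. emeasure \<nu> K)"
    unfolding \<nu>_\<Gamma>[symmetric] by (intro inner_regular sets_\<nu> \<Gamma>) simp
  \<comment> \<open>A supremum in \<open>ennreal\<close> is already attained along a sequence, so
    countably many compact sets suffice and their projections have a Borel union.\<close>
  then obtain h :: "nat \<Rightarrow> ennreal" where "range h \<subseteq> emeasure \<nu> ` {K. K \<subseteq> \<Gamma> \<and> compact K}"
    and SUP_h: "emeasure N (space N) = (SUP n. h n)"
    using ennreal_SUP_countable_SUP[of "{K. K \<subseteq> \<Gamma> \<and> compact K}" "emeasure \<nu>"]
      compact_empty empty_subsetI[of \<Gamma>]
    by (metis (no_types, lifting) empty_iff mem_Collect_eq)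
  then have "\<forall>n. \<exists>K. K \<subseteq> \<Gamma> \<and> compact K \<and> h n = emeasure \<nu> K"
    by blast
  then obtain K where K: "\<And>n. K n \<subseteq> \<Gamma>" "\<And>n. compact (K n)" "\<And>n. h n = emeasure \<nu> (K n)"
    by metis
  have snd_K: "snd ` K n \<in> sets borel" for n
    by (intro borel_closed compact_imp_closed compact_continuous_image K continuous_intros)
  define U where "U = (\<Union>n. snd ` K n)"
  have U [measurable]: "U \<in> sets borel"
    unfolding U_def using snd_K by blast
  have "h n \<le> emeasure (distr N borel f) U" for n
  proof -
    have "K n \<in> sets borel" using K(2) by (intro borel_closed compact_imp_closed)
    then have "h n = emeasure N ((\<lambda>s. (s, f s)) -` K n \<inter> space N)"
      unfolding K(3) \<nu>_def by (subst emeasure_distr) auto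
    also have "\<dots> \<le> emeasure N (f -` U \<inter> space N)"
    proof (rule emeasure_mono)
      show "(\<lambda>s. (s, f s)) -` K n \<inter> space N \<subseteq> f -` U \<inter> space N"
        by (force simp: U_def)
    qed measurable
    also have "\<dots> = emeasure (distr N borel f) U"
      by (subst emeasure_distr) auto
    finally show ?thesis .
  qed
  then have "emeasure N (space N) \<le> emeasure (distr N borel f) U"
    unfolding SUP_h by (intro SUP_least)
  then have "emeasure (distr N borel f) (space (distr N borel f) - U) = 0"
    by (subst emeasure_compl) (use dist in \<open>auto simp: diff_eq_0_iff_ennreal less_top[symmetric]\<close>)
  then have "AE x in distr N borel f. x \<in> U"
    by (intro AE_I[of _ _ "space (distr N borel f) - U"]) auto
  moreover have "U \<subseteq> f ` S"
    using K(1) by (force simp: U_def \<Gamma>_def)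
  ultimately show ?thesis by auto
qed

text \<open>Finite intersections of members of a countable basis form such a family. Stability under
  intersection lets finite measures be compared on \<open>E\<close>; countability lets almost sure
  equalities on its members be combined.\<close>

lemma countable_Int_stable_generator_borel:
  obtains E :: "'a::second_countable_topology set set"
  where "countable E" "Int_stable E" "UNIV \<in> E" "\<And>X. X \<in> E \<Longrightarrow> open X"
    "sets borel = sigma_sets UNIV E"
proof -
  obtain B :: "'a set set" where B: "countable B" "topological_basis B"
    using ex_countable_basis by blast
  define E where "E = Inter ` {F. finite F \<and> F \<subseteq> B}"
  have op: "open X" if "X \<in> E" for X
    using that topological_basis_open[OF B(2)] unfolding E_def by (auto intro!: open_Inter)
  have "B \<subseteq> E"
    unfolding E_def by (force intro!: image_eqI[of _ _ "{X}" for X])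
  \<comment> \<open>A family of open sets that contains a basis is itself a basis.\<close>
  then have basis: "topological_basis E"
    using B(2) op unfolding topological_basis_def by (meson subset_trans)
  have count: "countable E"
    unfolding E_def by (intro countable_image countable_Collect_finite_subset B)
  show thesis
  proof
    show "countable E" by fact
    show "Int_stable E"
      unfolding Int_stable_def E_def
    proof safe
      fix F G :: "'a set set" assume "finite F" "F \<subseteq> B" "finite G" "G \<subseteq> B"
      then show "\<Inter>F \<inter> \<Inter>G \<in> Inter ` {F. finite F \<and> F \<subseteq> B}"
        by (intro image_eqI[of _ _ "F \<union> G"]) auto
    qed
    show "UNIV \<in> E"
      unfolding E_def by (auto intro!: image_eqI[of _ _ "{}"])
    show "sets borel = sigma_sets UNIV E"
      unfolding borel_eq_countable_basis[OF count basis] by (simp add: sets_measure_of)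
  qed (rule op)
qed

text \<open>The codomain is arbitrary because both \<open>ennreal\<close>-valued functions and the
  measure-valued \<open>path_measure\<close> are reduced modulo \<tau>.\<close>

lemma periodic_of_int:
  fixes g :: "real \<Rightarrow> 'a"
  assumes periodic: "\<And>s. g (\<tau> + s) = g s"
  shows "g (of_int k * \<tau> + s) = g s"
proof (induction k arbitrary: s rule: int_induct[of _ 0])
  case (step1 i)
  have "g (of_int (i + 1) * \<tau> + s) = g (\<tau> + (of_int i * \<tau> + s))" by (simp add: algebra_simps)
  then show ?case using step1 periodic by simp
next
  case (step2 i)
  have "g (of_int i * \<tau> + s) = g (\<tau> + (of_int (i - 1) * \<tau> + s))" by (simp add: algebra_simps)
  then show ?case using step2 periodic by metis
qed simp

text \<open>Only the remainder \<open>r\<close> of \<open>t\<close> modulo \<tau> matters. Cutting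
  the period at \<open>\<tau> - r\<close> leaves two pieces whose translates tile the same period
  again.\<close>

lemma nn_integral_periodic_shift:
  fixes g :: "real \<Rightarrow> ennreal"
  assumes "0 < \<tau>" and g [measurable]: "g \<in> borel_measurable borel"
    and periodic: "\<And>s. g (\<tau> + s) = g s"
  shows "(\<integral>\<^sup>+s. g (t + s) * indicator {0..<\<tau>} s \<partial>lborel) = (\<integral>\<^sup>+s. g s * indicator {0..<\<tau>} s \<partial>lborel)"
proof -
  define k where "k = \<lfloor>t / \<tau>\<rfloor>"
  define r where "r = t - of_int k * \<tau>"
  have r: "0 \<le> r" "r < \<tau>"
    using floor_divide_lower[OF \<open>0 < \<tau>\<close>, of t] floor_divide_upper[OF \<open>0 < \<tau>\<close>, of t]
    unfolding r_def k_def by (simp_all add: algebra_simps)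
  \<comment> \<open>Here \<open>u\<close> is a period of \<open>g\<close> that is taken off along
    with the translation by \<open>r\<close>.\<close>
  have shift: "(\<integral>\<^sup>+s. g (r + s) * indicator {a..<b} s \<partial>lborel) =
     (\<integral>\<^sup>+s. g s * indicator {c..<d} s \<partial>lborel)"
     if "\<And>s. g (u + s) = g s" "c = a + r - u" "d = b + r - u" for a b c d u
  proof -
    have "(\<integral>\<^sup>+s. g s * indicator {c..<d} s \<partial>lborel) =
      (\<integral>\<^sup>+s. g (r - u + s) * indicator {c..<d} (r - u + s) \<partial>lborel)"
      by (subst nn_integral_real_affine[of _ 1 "r - u"]) auto
    also have "\<dots> = (\<integral>\<^sup>+s. g (r + s) * indicator {a..<b} s \<partial>lborel)"
      using that(1)[of "r - u + s" for s] that(2,3)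
      by (intro nn_integral_cong) (auto simp: algebra_simps split: split_indicator)
    finally show ?thesis by simp
  qed
  have split: "(\<integral>\<^sup>+s. h s * indicator {0..<\<tau>} s \<partial>lborel) =
     (\<integral>\<^sup>+s. h s * indicator {0..<c} s \<partial>lborel) + (\<integral>\<^sup>+s. h s * indicator {c..<\<tau>} s \<partial>lborel)"
    if "0 \<le> c" "c \<le> \<tau>" and [measurable]: "h \<in> borel_measurable borel" for c h
    using that by (subst nn_integral_add[symmetric])
      (auto intro!: nn_integral_cong split: split_indicator)
  have "(\<integral>\<^sup>+s. g (t + s) * indicator {0..<\<tau>} s \<partial>lborel) =
     (\<integral>\<^sup>+s. g (r + s) * indicator {0..<\<tau>} s \<partial>lborel)"
    using periodic_of_int[of g \<tau> k "r + s" for s] periodic by (simp add: r_def)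
  also have "\<dots> = (\<integral>\<^sup>+s. g (r + s) * indicator {0..<\<tau> - r} s \<partial>lborel) +
     (\<integral>\<^sup>+s. g (r + s) * indicator {\<tau> - r..<\<tau>} s \<partial>lborel)"
    using r by (intro split) auto
  \<comment> \<open>The first piece stays inside the period (\<open>u = 0\<close>); the second has
    run past its end and returns by one period (\<open>u = \<tau>\<close>).\<close>
  also have "\<dots> = (\<integral>\<^sup>+s. g s * indicator {r..<\<tau>} s \<partial>lborel) +
     (\<integral>\<^sup>+s. g s * indicator {0..<r} s \<partial>lborel)"
    using shift[of 0 r 0 \<tau> "\<tau> - r"] shift[of \<tau> 0 "\<tau> - r" r \<tau>] periodic by simp
  also have "\<dots> = (\<integral>\<^sup>+s. g s * indicator {0..<\<tau>} s \<partial>lborel)"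
    using r by (subst split[of r g]) (auto simp: add.commute)
  finally show ?thesis .
qed

lemma section_at_eq_vimage: "section_at A \<omega> = Pair \<omega> -` A"
  by (auto simp: section_at_def)

text \<open>Tested on rectangles \<open>C \<times> X\<close>, both kernels evaluated at
  \<open>X\<close> are densities of the same measure in \<open>C\<close>, so they agree off a null
  set depending on \<open>X\<close>. A countable generator closed under intersection removes that
  dependence.\<close>

lemma AE_random_factorisation_unique:
  fixes \<kappa> \<kappa>' :: "'w \<Rightarrow> 'x::second_countable_topology measure"
  assumes "finite_measure M" and \<kappa>: "random_factorisation M \<mu> \<kappa>" and \<kappa>': "random_factorisation M \<mu> \<kappa>'"
  shows "AE \<omega> in M. \<kappa> \<omega> = \<kappa>' \<omega>"
proof -
  interpret finite_measure M by fact
  note meas [measurable] = measurable_prob_algebraD[OF \<kappa>[unfolded random_factorisation_def, THEN conjunct1]]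
    measurable_prob_algebraD[OF \<kappa>'[unfolded random_factorisation_def, THEN conjunct1]]
  obtain E :: "'x set set" where E: "countable E" "Int_stable E" "UNIV \<in> E" "\<And>X. X \<in> E \<Longrightarrow> open X"
    "sets borel = sigma_sets UNIV E"
    using countable_Int_stable_generator_borel by blast
  have eq: "AE \<omega> in M. emeasure (\<kappa> \<omega>) X = emeasure (\<kappa>' \<omega>) X" if X: "X \<in> sets borel" for X
  proof (rule density_unique_finite_measure)
    show [measurable]: "(\<lambda>\<omega>. emeasure (\<kappa> \<omega>) X) \<in> borel_measurable M"
      "(\<lambda>\<omega>. emeasure (\<kappa>' \<omega>) X) \<in> borel_measurable M"
      by (auto intro!: measurable_compose[OF _ measurable_emeasure_subprob_algebra[OF X]])
    fix C assume C: "C \<in> sets M"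
    have *: "(\<integral>\<^sup>+\<omega>. emeasure (\<kappa> \<omega>) X * indicator C \<omega> \<partial>M) = emeasure \<mu> (C \<times> X)"
      if "random_factorisation M \<mu> \<kappa>" for \<kappa>
      using that C X unfolding random_factorisation_def
      by (auto simp: section_at_def intro!: nn_integral_cong split: split_indicator)
    show "(\<integral>\<^sup>+\<omega>. emeasure (\<kappa> \<omega>) X * indicator C \<omega> \<partial>M) = (\<integral>\<^sup>+\<omega>. emeasure (\<kappa>' \<omega>) X * indicator C \<omega> \<partial>M)"
      using *[OF \<kappa>] *[OF \<kappa>'] by simp
  qed auto
  have "AE \<omega> in M. \<forall>X\<in>E. emeasure (\<kappa> \<omega>) X = emeasure (\<kappa>' \<omega>) X"
    using E(1,4) by (subst AE_ball_countable) (auto intro!: eq)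
  then show ?thesis
    using AE_space
  proof eventually_elim
    case (elim \<omega>)
    have sets: "sets (\<kappa> \<omega>) = sets borel" "sets (\<kappa>' \<omega>) = sets borel"
      using subprob_measurableD(2)[OF meas(1) elim(2)] subprob_measurableD(2)[OF meas(2) elim(2)] by simp_all
    have "subprob_space (\<kappa> \<omega>)"
      using subprob_space_kernel[OF meas(1) elim(2)] .
    then interpret subprob_space "\<kappa> \<omega>" .
    show ?case
      using E elim(1) sets by (intro measure_eqI_generator_eq[where E = E and \<Omega> = UNIV and A = "\<lambda>_. UNIV"]) auto
  qed
qed


section \<open>Measurability of the cocycle and the skew product\<close>

text \<open>Converts the time space \<open>restrict_space borel {0..}\<close> of the cocycle axiom
  to ordinary Borel time, for use under composition.\<close>

lemma (in random_dynamical_system) cocycle_measurable':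
  assumes f [measurable]: "f \<in> N \<rightarrow>\<^sub>M borel" and g [measurable]: "g \<in> N \<rightarrow>\<^sub>M M"
    and h [measurable]: "h \<in> N \<rightarrow>\<^sub>M borel"
    and nonneg: "\<And>z. z \<in> space N \<Longrightarrow> 0 \<le> f z"
  shows "(\<lambda>z. \<Phi> (f z) (g z) (h z)) \<in> N \<rightarrow>\<^sub>M borel"
proof -
  have "f \<in> N \<rightarrow>\<^sub>M restrict_space borel {0..}"
    using nonneg by (intro measurable_restrict_space2) auto
  then have "(\<lambda>z. (f z, g z, h z)) \<in> N \<rightarrow>\<^sub>M restrict_space borel {0..} \<Otimes>\<^sub>M (M \<Otimes>\<^sub>M borel)"
    by measurable
  from measurable_compose[OF this cocycle_measurable] show ?thesis by simp
qed

lemma (in random_dynamical_system) skew_product_measurable: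
  assumes "0 \<le> t"
  shows "skew_product \<theta> \<Phi> t \<in> M \<Otimes>\<^sub>M borel \<rightarrow>\<^sub>M M \<Otimes>\<^sub>M borel"
proof -
  note [measurable] = flow_measurable_at
  have [measurable]: "(\<lambda>z. \<Phi> t (fst z) (snd z)) \<in> M \<Otimes>\<^sub>M borel \<rightarrow>\<^sub>M borel"
    using assms by (intro cocycle_measurable') auto
  show ?thesis
    unfolding skew_product_def case_prod_beta by measurable
qed

section \<open>The random periodic path and its jointly measurable version\<close>

locale random_periodic_system = random_dynamical_system M \<theta> \<Phi>
  for M :: "'w measure" and \<theta> :: "real \<Rightarrow> 'w \<Rightarrow> 'w"
    and \<Phi> :: "real \<Rightarrow> 'w \<Rightarrow> 'x::polish_space \<Rightarrow> 'x" +
  fixes \<tau> :: real and Y :: "real \<Rightarrow> 'w \<Rightarrow> 'x"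
  assumes period_pos: "0 < \<tau>"
    and path: "random_periodic_path M \<theta> \<Phi> \<tau> Y"
begin

lemma path_measurable [measurable]: "Y s \<in> M \<rightarrow>\<^sub>M borel"
  using path by (simp add: random_periodic_path_def)

lemma AE_path_cocycle: "AE \<omega> in M. \<forall>t\<ge>0. \<forall>s. \<Phi> t (\<theta> s \<omega>) (Y s \<omega>) = Y (t + s) \<omega>"
  using path by (auto simp: random_periodic_path_def)

lemma AE_path_periodic: "AE \<omega> in M. \<forall>s. Y (s + \<tau>) \<omega> = Y s (\<theta> \<tau> \<omega>)"
  using path by (auto simp: random_periodic_path_def)

lemmas [measurable] = flow_measurable flow_measurable_at

lemma flow_measurable_compose [measurable (raw)]:
  assumes "f \<in> N \<rightarrow>\<^sub>M borel" "g \<in> N \<rightarrow>\<^sub>M M"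
  shows "(\<lambda>z. \<theta> (f z) (g z)) \<in> N \<rightarrow>\<^sub>M M"
  using measurable_compose[OF measurable_Pair[OF assms] flow_measurable] by simp

text \<open>
  The truncation at \<open>0\<close> only serves to make the version measurable on all of \<open>\<real> \<times> \<Omega>\<close>; it agrees
  with the path at nonnegative times.
\<close>

definition path_version :: "real \<Rightarrow> 'w \<Rightarrow> 'x" where
  "path_version s \<omega> = \<Phi> (max 0 s) \<omega> (Y 0 \<omega>)"

lemma path_version_measurable [measurable (raw)]:
  assumes [measurable]: "f \<in> N \<rightarrow>\<^sub>M borel" "g \<in> N \<rightarrow>\<^sub>M M"
  shows "(\<lambda>z. path_version (f z) (g z)) \<in> N \<rightarrow>\<^sub>M borel"
  unfolding path_version_def by (intro cocycle_measurable') auto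

text \<open>This is the cocycle identity of the path started at time 0; its single null set serves
  all times at once.\<close>

lemma AE_path_version: "AE \<omega> in M. \<forall>s\<ge>0. path_version s \<omega> = Y s \<omega>"
  using AE_path_cocycle AE_space
proof eventually_elim
  case (elim \<omega>)
  then show ?case
    using elim(1)[rule_format, of _ 0] flow_zero[of \<omega>] by (auto simp: path_version_def)
qed

section \<open>The periodic measure\<close>

definition path_measure :: "real \<Rightarrow> ('w \<times> 'x) measure" where
  "path_measure s = distr M (M \<Otimes>\<^sub>M borel) (\<lambda>\<omega>. (\<theta> s \<omega>, Y s \<omega>))"

lemma sets_path_measure [simp, measurable_cong]: "sets (path_measure s) = sets (M \<Otimes>\<^sub>M borel)"
  by (simp add: path_measure_def)

lemma path_measure_marginal: "path_measure s \<in> prob_measures_with_marginal M"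
proof -
  have "distr (path_measure s) M fst = distr M M (\<theta> s)"
    unfolding path_measure_def by (subst distr_distr) (auto simp: comp_def)
  moreover have "prob_space (path_measure s)"
    unfolding path_measure_def by (rule prob_space_distr) simp
  ultimately show ?thesis
    by (simp add: prob_measures_with_marginal_def flow_preserves)
qed

lemma path_measure_push:
  assumes "0 \<le> t"
  shows "distr (path_measure s) (M \<Otimes>\<^sub>M borel) (skew_product \<theta> \<Phi> t) = path_measure (t + s)"
proof -
  note [measurable] = skew_product_measurable[OF assms]
  have "distr (path_measure s) (M \<Otimes>\<^sub>M borel) (skew_product \<theta> \<Phi> t) =
      distr M (M \<Otimes>\<^sub>M borel) (\<lambda>\<omega>. skew_product \<theta> \<Phi> t (\<theta> s \<omega>, Y s \<omega>))"
    unfolding path_measure_def by (subst distr_distr) (auto simp: comp_def)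
  also have "\<dots> = path_measure (t + s)"
    unfolding path_measure_def
  proof (rule distr_cong_AE)
    show "AE \<omega> in M. skew_product \<theta> \<Phi> t (\<theta> s \<omega>, Y s \<omega>) = (\<theta> (t + s) \<omega>, Y (t + s) \<omega>)"
      using AE_path_cocycle AE_space
      by eventually_elim (use assms in \<open>simp add: skew_product_def flow_add\<close>)
  qed auto
  finally show ?thesis .
qed

text \<open>Almost surely, advancing time by \<tau> amounts to replacing \<omega> by
  \<open>\<theta> \<tau> \<omega>\<close>, and this substitution preserves \<open>M\<close>.\<close>

lemma path_measure_periodic: "path_measure (\<tau> + s) = path_measure s"
proof -
  have "path_measure (\<tau> + s) = distr M (M \<Otimes>\<^sub>M borel) (\<lambda>\<omega>. (\<theta> s (\<theta> \<tau> \<omega>), Y s (\<theta> \<tau> \<omega>)))"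
    unfolding path_measure_def
  proof (rule distr_cong_AE)
    show "AE \<omega> in M. (\<theta> (\<tau> + s) \<omega>, Y (\<tau> + s) \<omega>) = (\<theta> s (\<theta> \<tau> \<omega>), Y s (\<theta> \<tau> \<omega>))"
      using AE_path_periodic AE_space
      by eventually_elim (simp add: flow_add[symmetric] add.commute[of \<tau>])
  qed auto
  also have "\<dots> = distr (distr M M (\<theta> \<tau>)) (M \<Otimes>\<^sub>M borel) (\<lambda>\<omega>. (\<theta> s \<omega>, Y s \<omega>))"
    by (subst distr_distr) (auto simp: comp_def)
  finally show ?thesis
    by (simp add: flow_preserves path_measure_def)
qed

lemma periodic_measure_path_measure: "periodic_measure M \<theta> \<Phi> \<tau> path_measure"
  by (simp add: periodic_measure_def path_measure_marginal path_measure_periodic path_measure_push)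

lemma emeasure_path_measure:
  assumes A: "A \<in> sets (M \<Otimes>\<^sub>M borel)"
  shows "emeasure (path_measure s) A =
    (\<integral>\<^sup>+\<omega>. emeasure (return borel (Y s \<omega>)) (section_at A (\<theta> s \<omega>)) \<partial>M)"
proof -
  have "emeasure (path_measure s) A = (\<integral>\<^sup>+\<omega>. indicator A (\<theta> s \<omega>, Y s \<omega>) \<partial>M)"
    using A by (subst nn_integral_indicator[symmetric])
      (auto simp: path_measure_def nn_integral_distr simp del: nn_integral_indicator)
  also have "\<dots> = (\<integral>\<^sup>+\<omega>. emeasure (return borel (Y s \<omega>)) (section_at A (\<theta> s \<omega>)) \<partial>M)"
    using sets_Pair1[OF A]
    by (intro nn_integral_cong) (auto simp: section_at_eq_vimage split: split_indicator)
  finally show ?thesis .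
qed

text \<open>With the version in place of \<open>Y\<close>, the integrand is jointly measurable in
  time and \<omega>, as Fubini requires.\<close>

lemma emeasure_path_measure_version:
  assumes [measurable]: "A \<in> sets (M \<Otimes>\<^sub>M borel)" and "0 \<le> s"
  shows "emeasure (path_measure s) A = (\<integral>\<^sup>+\<omega>. indicator A (\<theta> s \<omega>, path_version s \<omega>) \<partial>M)"
proof -
  have "path_measure s = distr M (M \<Otimes>\<^sub>M borel) (\<lambda>\<omega>. (\<theta> s \<omega>, path_version s \<omega>))"
    unfolding path_measure_def
    by (rule distr_cong_AE) (use AE_path_version \<open>0 \<le> s\<close> in auto)
  then have "emeasure (path_measure s) A =
      (\<integral>\<^sup>+z. indicator A z \<partial>distr M (M \<Otimes>\<^sub>M borel) (\<lambda>\<omega>. (\<theta> s \<omega>, path_version s \<omega>)))"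
    by simp
  also have "\<dots> = (\<integral>\<^sup>+\<omega>. indicator A (\<theta> s \<omega>, path_version s \<omega>) \<partial>M)"
    by (rule nn_integral_distr) auto
  finally show ?thesis .
qed

lemma emeasure_path_measure_measurable [measurable]:
  assumes [measurable]: "A \<in> sets (M \<Otimes>\<^sub>M borel)"
  shows "(\<lambda>s. emeasure (path_measure s) A) \<in> borel_measurable borel"
proof -
  \<comment> \<open>The version represents the path only at nonnegative times; reduction modulo
    \<tau> moves every \<open>s\<close> there without changing
    \<open>path_measure s\<close>.\<close>
  define r where "r s = s - of_int \<lfloor>s / \<tau>\<rfloor> * \<tau>" for s
  have [measurable]: "r \<in> borel_measurable borel"
    unfolding r_def by measurable
  have "0 \<le> r s" for s
    using floor_divide_lower[OF period_pos, of s] by (simp add: r_def)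
  moreover have "path_measure (r s) = path_measure s" for s
    using periodic_of_int[of path_measure \<tau> "\<lfloor>s / \<tau>\<rfloor>" "r s"] path_measure_periodic by (simp add: r_def)
  ultimately have "emeasure (path_measure s) A =
      (\<integral>\<^sup>+\<omega>. indicator A (\<theta> (r s) \<omega>, path_version (r s) \<omega>) \<partial>M)" for s
    using emeasure_path_measure_version[OF assms, of "r s"] by simp
  then show ?thesis
    by simp
qed

section \<open>The time average and its invariance\<close>

text \<open>Averaging over a period becomes expectation over a random phase. The half-open interval
  matches the index set of \<open>path_range\<close>.\<close>

definition phase :: "real measure" where
  "phase = uniform_measure lborel {0..<\<tau>}"

lemma sets_phase [simp, measurable_cong]: "sets phase = sets borel"
  by (simp add: phase_def)

lemma space_phase [simp]: "space phase = UNIV"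
  by (simp add: phase_def)

sublocale phase: prob_space phase
  unfolding phase_def by (rule prob_space_uniform_measure) (use period_pos in auto)

lemma AE_phase: "AE s in phase. s \<in> {0..<\<tau>}"
  unfolding phase_def by (rule AE_uniform_measureI) auto

lemma nn_integral_phase:
  assumes [measurable]: "f \<in> borel_measurable borel"
  shows "(\<integral>\<^sup>+s. f s \<partial>phase) = ennreal (1 / \<tau>) * (\<integral>\<^sup>+s\<in>{0..<\<tau>}. f s \<partial>lborel)"
  unfolding phase_def using period_pos
  by (subst nn_integral_uniform_measure)
    (auto simp: divide_ennreal_def inverse_ennreal inverse_eq_divide mult.commute)

sublocale phase_M: pair_prob_space phase M ..

text \<open>As a push-forward of a product measure it is a measure by construction, and Fubini
  applies; \<open>emeasure_average_measure\<close> recovers the mixture of the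
  \<open>path_measure s\<close>.\<close>

definition average_measure :: "('w \<times> 'x) measure" where
  "average_measure = distr (phase \<Otimes>\<^sub>M M) (M \<Otimes>\<^sub>M borel) (\<lambda>(s, \<omega>). (\<theta> s \<omega>, path_version s \<omega>))"

lemma sets_average_measure [simp, measurable_cong]: "sets average_measure = sets (M \<Otimes>\<^sub>M borel)"
  by (simp add: average_measure_def)

lemma emeasure_average_measure_version:
  assumes [measurable]: "A \<in> sets (M \<Otimes>\<^sub>M borel)"
  shows "emeasure average_measure A =
    (\<integral>\<^sup>+s. \<integral>\<^sup>+\<omega>. indicator A (\<theta> s \<omega>, path_version s \<omega>) \<partial>M \<partial>phase)"
proof -
  have "emeasure average_measure A = (\<integral>\<^sup>+z. indicator A z \<partial>average_measure)"
    by simp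
  also have "\<dots> = (\<integral>\<^sup>+z. indicator A (\<theta> (fst z) (snd z), path_version (fst z) (snd z)) \<partial>(phase \<Otimes>\<^sub>M M))"
    unfolding average_measure_def case_prod_beta by (rule nn_integral_distr) auto
  also have "\<dots> = (\<integral>\<^sup>+s. \<integral>\<^sup>+\<omega>. indicator A (\<theta> s \<omega>, path_version s \<omega>) \<partial>M \<partial>phase)"
    by (subst nn_integral_fst[symmetric]) auto
  finally show ?thesis .
qed

lemma emeasure_average_measure:
  assumes [measurable]: "A \<in> sets (M \<Otimes>\<^sub>M borel)"
  shows "emeasure average_measure A = (\<integral>\<^sup>+s. emeasure (path_measure s) A \<partial>phase)"
  unfolding emeasure_average_measure_version[OF assms]
  by (rule nn_integral_cong_AE) (use AE_phase in \<open>eventually_elim, simp add: emeasure_path_measure_version\<close>)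

lemma time_average_average_measure: "time_average \<tau> path_measure average_measure"
  unfolding time_average_def
proof (intro conjI ballI)
  fix A assume "A \<in> sets average_measure"
  then have A [measurable]: "A \<in> sets (M \<Otimes>\<^sub>M borel)" by simp
  show "(\<lambda>s. emeasure (path_measure s) A) \<in> borel_measurable borel"
    by measurable
  \<comment> \<open>The end point is Lebesgue null, which reconciles the half-open interval of
    \<open>phase\<close> with the closed one of \<open>time_average\<close>.\<close>
  have "AE s in lborel. s \<noteq> \<tau>"
    by (rule AE_lborel_singleton)
  then have "(\<integral>\<^sup>+s\<in>{0..<\<tau>}. emeasure (path_measure s) A \<partial>lborel) = (\<integral>\<^sup>+s\<in>{0..\<tau>}. emeasure (path_measure s) A \<partial>lborel)"
    by (intro nn_integral_cong_AE, eventually_elim) (auto split: split_indicator)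
  then show "emeasure average_measure A = ennreal (1 / \<tau>) * (\<integral>\<^sup>+s\<in>{0..\<tau>}. emeasure (path_measure s) A \<partial>lborel)"
    by (simp add: emeasure_average_measure nn_integral_phase)
qed

text \<open>Marginal and push-forward are computed phase by phase; pushing by time \<open>t\<close>
  merely translates the phase by \<open>t\<close>.\<close>

lemma invariant_measure_average_measure: "invariant_measure M \<theta> \<Phi> average_measure"
proof -
  have prob: "prob_space average_measure"
    unfolding average_measure_def by (rule phase_M.prob_space_distr) simp
  have marginal: "distr average_measure M fst = M"
  proof (rule measure_eqI)
    fix B assume "B \<in> sets (distr average_measure M fst)"
    then have [measurable]: "B \<in> sets M" by simp
    have "emeasure (distr average_measure M fst) B =
        (\<integral>\<^sup>+s. emeasure (path_measure s) (fst -` B \<inter> space (M \<Otimes>\<^sub>M borel)) \<partial>phase)"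
      by (subst emeasure_distr)
        (auto simp: emeasure_average_measure sets_eq_imp_space_eq[OF sets_average_measure])
    also have "\<dots> = (\<integral>\<^sup>+s. emeasure (distr (path_measure s) M fst) B \<partial>phase)"
      by (subst emeasure_distr) (auto simp: sets_eq_imp_space_eq[OF sets_path_measure])
    also have "\<dots> = emeasure M B"
      using path_measure_marginal phase.emeasure_space_1 by (simp add: prob_measures_with_marginal_def)
    finally show "emeasure (distr average_measure M fst) B = emeasure M B" .
  qed simp
  have "distr average_measure (M \<Otimes>\<^sub>M borel) (skew_product \<theta> \<Phi> t) = average_measure" if t: "0 \<le> t" for t
  proof (rule measure_eqI)
    fix A assume "A \<in> sets (distr average_measure (M \<Otimes>\<^sub>M borel) (skew_product \<theta> \<Phi> t))"
    then have [measurable]: "A \<in> sets (M \<Otimes>\<^sub>M borel)" by simp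
    note [measurable] = skew_product_measurable[OF t]
    have "emeasure (distr average_measure (M \<Otimes>\<^sub>M borel) (skew_product \<theta> \<Phi> t)) A =
        (\<integral>\<^sup>+s. emeasure (path_measure s) (skew_product \<theta> \<Phi> t -` A \<inter> space (M \<Otimes>\<^sub>M borel)) \<partial>phase)"
      by (subst emeasure_distr)
        (auto simp: emeasure_average_measure sets_eq_imp_space_eq[OF sets_average_measure])
    also have "\<dots> = (\<integral>\<^sup>+s. emeasure (distr (path_measure s) (M \<Otimes>\<^sub>M borel) (skew_product \<theta> \<Phi> t)) A \<partial>phase)"
      by (subst emeasure_distr) (auto simp: sets_eq_imp_space_eq[OF sets_path_measure])
    also have "\<dots> = (\<integral>\<^sup>+s. emeasure (path_measure (t + s)) A \<partial>phase)"
      by (simp add: path_measure_push t)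
    \<comment> \<open>The integrand is \<tau>-periodic in \<open>s\<close>, so the translation does
      not affect its integral over one period.\<close>
    also have "\<dots> = (\<integral>\<^sup>+s. emeasure (path_measure s) A \<partial>phase)"
      using nn_integral_periodic_shift[OF period_pos, of "\<lambda>s. emeasure (path_measure s) A" t]
      by (simp add: nn_integral_phase path_measure_periodic)
    finally show "emeasure (distr average_measure (M \<Otimes>\<^sub>M borel) (skew_product \<theta> \<Phi> t)) A = emeasure average_measure A"
      by (simp add: emeasure_average_measure)
  qed simp
  with prob marginal show ?thesis
    by (simp add: invariant_measure_def prob_measures_with_marginal_def)
qed

section \<open>The random factorisation and its support\<close>

text \<open>A version of the conditional law of the state given \<omega> under
  \<open>average_measure\<close>. Starting from \<open>\<theta> (- s) \<omega>\<close> makes the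
  path sit over \<omega> at time \<open>s\<close>.\<close>

definition average_kernel :: "'w \<Rightarrow> 'x measure" where
  "average_kernel \<omega> = distr phase borel (\<lambda>s. path_version s (\<theta> (- s) \<omega>))"

lemma random_factorisation_average_kernel: "random_factorisation M average_measure average_kernel"
  unfolding random_factorisation_def
proof (intro conjI ballI)
  have "phase \<in> space (prob_algebra borel)"
    using phase.prob_space_axioms by (simp add: space_prob_algebra)
  then have "(\<lambda>_. phase) \<in> M \<rightarrow>\<^sub>M prob_algebra borel"
    by simp
  then show "average_kernel \<in> M \<rightarrow>\<^sub>M prob_algebra borel"
    unfolding average_kernel_def by (rule measurable_distr_prob_space2) measurable
  fix A :: "('w \<times> 'x) set" assume A [measurable]: "A \<in> sets (M \<Otimes>\<^sub>M borel)"
  have "emeasure average_measure A =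
      (\<integral>\<^sup>+s. \<integral>\<^sup>+\<omega>. indicator A (\<omega>, path_version s (\<theta> (- s) \<omega>)) \<partial>M \<partial>phase)"
    unfolding emeasure_average_measure_version[OF A]
  proof (rule nn_integral_cong)
    fix s
    \<comment> \<open>Invariance of \<open>M\<close> under \<open>\<theta> (- s)\<close> turns the
      base point into \<omega> for every phase, so that exchanging the integrals exposes the
      sections of \<open>A\<close>.\<close>
    have "(\<integral>\<^sup>+\<omega>. indicator A (\<theta> s \<omega>, path_version s \<omega>) \<partial>M) =
        (\<integral>\<^sup>+\<omega>. indicator A (\<theta> s \<omega>, path_version s \<omega>) \<partial>distr M M (\<theta> (- s)))"
      by (simp add: flow_preserves)
    also have "\<dots> = (\<integral>\<^sup>+\<omega>. indicator A (\<theta> s (\<theta> (- s) \<omega>), path_version s (\<theta> (- s) \<omega>)) \<partial>M)"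
      by (rule nn_integral_distr) auto
    also have "\<dots> = (\<integral>\<^sup>+\<omega>. indicator A (\<omega>, path_version s (\<theta> (- s) \<omega>)) \<partial>M)"
      by (intro nn_integral_cong) (simp add: flow_inverse)
    finally show "(\<integral>\<^sup>+\<omega>. indicator A (\<theta> s \<omega>, path_version s \<omega>) \<partial>M) =
        (\<integral>\<^sup>+\<omega>. indicator A (\<omega>, path_version s (\<theta> (- s) \<omega>)) \<partial>M :: ennreal)" .
  qed
  also have "\<dots> = (\<integral>\<^sup>+\<omega>. \<integral>\<^sup>+s. indicator A (\<omega>, path_version s (\<theta> (- s) \<omega>)) \<partial>phase \<partial>M)"
    by (rule phase_M.Fubini'[symmetric]) measurable
  also have "\<dots> = (\<integral>\<^sup>+\<omega>. emeasure (average_kernel \<omega>) (section_at A \<omega>) \<partial>M)"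
  proof (rule nn_integral_cong)
    fix \<omega> assume [measurable]: "\<omega> \<in> space M"
    have sec [measurable]: "section_at A \<omega> \<in> sets borel"
      unfolding section_at_eq_vimage by (rule sets_Pair1[OF A])
    have "emeasure (average_kernel \<omega>) (section_at A \<omega>) =
        (\<integral>\<^sup>+x. indicator (section_at A \<omega>) x \<partial>average_kernel \<omega>)"
      by (simp add: average_kernel_def)
    also have "\<dots> = (\<integral>\<^sup>+s. indicator (section_at A \<omega>) (path_version s (\<theta> (- s) \<omega>)) \<partial>phase)"
      unfolding average_kernel_def by (rule nn_integral_distr) auto
    finally show "(\<integral>\<^sup>+s. indicator A (\<omega>, path_version s (\<theta> (- s) \<omega>)) \<partial>phase) =
        emeasure (average_kernel \<omega>) (section_at A \<omega>)"
      by (simp add: section_at_eq_vimage indicator_def)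
  qed
  finally show "emeasure average_measure A =
      (\<integral>\<^sup>+\<omega>. emeasure (average_kernel \<omega>) (section_at A \<omega>) \<partial>M)" .
qed

text \<open>The version may differ from \<open>Y\<close> at \<open>\<theta> (- s) \<omega>\<close>
  for some phases. By Fubini these are negligible for almost every \<omega>, and
  \<open>AE_distr_image\<close> places the mass on the image of the others.\<close>

lemma AE_average_kernel_path_range:
  "AE \<omega> in M. AE x in average_kernel \<omega>. x \<in> path_range \<theta> \<tau> Y \<omega>"
proof -
  \<comment> \<open>The exceptional set involves uncountably many times and may fail to be
    measurable, hence the measurable null superset \<open>N\<close>.\<close>
  obtain N where N: "{\<omega> \<in> space M. \<not> (\<forall>s\<ge>0. path_version s \<omega> = Y s \<omega>)} \<subseteq> N"
    "emeasure M N = 0" and N_sets [measurable]: "N \<in> sets M"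
    using AE_E[OF AE_path_version] by blast
  have "AE \<omega> in M. \<theta> (- s) \<omega> \<notin> N" for s
  proof -
    have "AE \<omega> in distr M M (\<theta> (- s)). \<omega> \<notin> N"
      unfolding flow_preserves using N(2) by (intro AE_not_in) auto
    then show ?thesis
      by (subst (asm) AE_distr_iff) auto
  qed
  then have "AE s in phase. AE \<omega> in M. \<theta> (- s) \<omega> \<notin> N"
    by simp
  moreover have "{z \<in> space (phase \<Otimes>\<^sub>M M). \<theta> (- fst z) (snd z) \<notin> N} \<in> sets (phase \<Otimes>\<^sub>M M)"
    by measurable
  \<comment> \<open>Each fixed phase has its own null set of \<omega>; the exchange yields almost
    every \<omega> with a null set of phases.\<close>
  ultimately have "AE \<omega> in M. AE s in phase. \<theta> (- s) \<omega> \<notin> N"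
    by (simp only: phase_M.AE_commute)
  then show ?thesis
    using AE_space
  proof eventually_elim
    case (elim \<omega>)
    define S where "S = {s \<in> {0..<\<tau>}. \<theta> (- s) \<omega> \<notin> N}"
    note [measurable] = elim(2)
    have "{s \<in> space borel. s \<in> {0..<\<tau>} \<and> \<theta> (- s) \<omega> \<notin> N} \<in> sets borel"
      by measurable
    then have [measurable]: "S \<in> sets borel"
      by (simp add: S_def)
    have "AE s in phase. s \<in> S"
      using elim(1) AE_phase by eventually_elim (simp add: S_def)
    then have "AE x in average_kernel \<omega>. x \<in> (\<lambda>s. path_version s (\<theta> (- s) \<omega>)) ` S"
      unfolding average_kernel_def by (intro AE_distr_image phase.finite_measure_axioms) auto
    moreover have "(\<lambda>s. path_version s (\<theta> (- s) \<omega>)) ` S \<subseteq> path_range \<theta> \<tau> Y \<omega>"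
    proof -
      have "path_version s (\<theta> (- s) \<omega>) = Y s (\<theta> (- s) \<omega>)" if "s \<in> S" for s
        using that N(1) measurable_space[OF flow_measurable_at elim(2)] by (auto simp: S_def)
      then show ?thesis
        by (auto simp: path_range_def S_def)
    qed
    ultimately show ?case
      by auto
  qed
qed

end

theorem theorem3p2:
  fixes M :: "'w measure"
    and \<theta> :: "real \<Rightarrow> 'w \<Rightarrow> 'w"
    and \<Phi> :: "real \<Rightarrow> 'w \<Rightarrow> 'x::polish_space \<Rightarrow> 'x"
    and \<tau> :: real
    and Y :: "real \<Rightarrow> 'w \<Rightarrow> 'x"
  assumes "random_dynamical_system M \<theta> \<Phi>"
    and "0 < \<tau>"
    and "random_periodic_path M \<theta> \<Phi> \<tau> Y"
  shows "\<exists>\<mu> \<mu>bar.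
    periodic_measure M \<theta> \<Phi> \<tau> \<mu> \<and>
    (\<forall>s. \<forall>A\<in>sets (M \<Otimes>\<^sub>M borel).
      emeasure (\<mu> s) A = (\<integral>\<^sup>+\<omega>. emeasure (return borel (Y s \<omega>)) (section_at A (\<theta> s \<omega>)) \<partial>M)) \<and>
    time_average \<tau> \<mu> \<mu>bar \<and>
    invariant_measure M \<theta> \<Phi> \<mu>bar \<and>
    (\<exists>\<kappa>. random_factorisation M \<mu>bar \<kappa>) \<and>
    (\<forall>\<kappa>. random_factorisation M \<mu>bar \<kappa> \<longrightarrow>
      (AE \<omega> in M. AE x in \<kappa> \<omega>. x \<in> path_range \<theta> \<tau> Y \<omega>))"
proof -
  interpret random_dynamical_system M \<theta> \<Phi> by fact
  interpret random_periodic_system M \<theta> \<Phi> \<tau> Y by unfold_locales fact+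
  \<comment> \<open>Almost sure uniqueness carries the support property from
    \<open>average_kernel\<close> to an arbitrary factorisation.\<close>
  have "AE \<omega> in M. AE x in \<kappa> \<omega>. x \<in> path_range \<theta> \<tau> Y \<omega>"
    if "random_factorisation M average_measure \<kappa>" for \<kappa>
    using AE_random_factorisation_unique[OF finite_measure_axioms that random_factorisation_average_kernel]
      AE_average_kernel_path_range
    by eventually_elim (simp only:)
  then show ?thesis
    using periodic_measure_path_measure emeasure_path_measure time_average_average_measure
      invariant_measure_average_measure random_factorisation_average_kernel
    by blast
qed

end
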